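(* Let $n\ge 1$, let $B\in\mathbb{R}^{2n\times 2n}$ be a symmetric matrix, and let $J=\begin{bmatrix}0&-I_n\\ I_n&0\end{bmatrix}\in\mathbb{R}^{2n\times 2n}$. Let $W$ be a linear subspace of $\mathbb{R}^{2n}$ that is both $J$-invariant and $B$-invariant (i.e. $JW\subset W$ and $BW\subset W$). Assume that $B$ restricted to $W$ is an isomorphism of $W$. If $JB$ is spectrally stable, then the Morse index of $B$ restricted to $W$ is even.
   Context: The matrix $JB\in\mathbb{R}^{2n\times 2n}$ is called spectrally stable if all of its (complex) eigenvalues lie on the imaginary axis. The Morse index of $B$ restricted to $W$ is the number of negative eigenvalues, counted with multiplicity, of the symmetric operator $B|_W:W\to W$ (symmetric with respect to the Euclidean inner product of $\mathbb{R}^{2n}$ restricted to $W$). *)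

theory Defs
  imports "HOL-Analysis.Analysis"
begin

text \<open>
  The index type \<open>'n + 'n\<close> splits \<open>\<real>\<^sup>2\<^sup>n\<close> (\<open>n = CARD('n)\<close>) into two blocks of size \<open>n\<close>:
  \<open>Inl\<close> indexes the first block and \<open>Inr\<close> the second.
\<close>

definition symplectic_J :: "real ^ ('n::finite + 'n) ^ ('n + 'n)" where
  "symplectic_J = (\<chi> i j. case (i, j) of
      (Inl a, Inr b) \<Rightarrow> (if a = b then -1 else 0)
    | (Inr a, Inl b) \<Rightarrow> (if a = b then 1 else 0)
    | _ \<Rightarrow> 0)"

definition eigenvalue :: "'a::field ^ 'n ^ 'n::finite \<Rightarrow> 'a \<Rightarrow> bool" where
  "eigenvalue A c \<longleftrightarrow> (\<exists>v. v \<noteq> 0 \<and> A *v v = c *s v)"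

definition spectrally_stable :: "real ^ 'n ^ 'n::finite \<Rightarrow> bool" where
  "spectrally_stable A \<longleftrightarrow> (\<forall>c. eigenvalue (map_matrix complex_of_real A) c \<longrightarrow> Re c = 0)"

definition eigenspace_on :: "(real ^ 'n::finite) set \<Rightarrow> real ^ 'n ^ 'n \<Rightarrow> real \<Rightarrow> (real ^ 'n) set" where
  "eigenspace_on W A c = {v \<in> W. A *v v = c *s v}"

definition eigenvalue_on :: "(real ^ 'n::finite) set \<Rightarrow> real ^ 'n ^ 'n \<Rightarrow> real \<Rightarrow> bool" where
  "eigenvalue_on W A c \<longleftrightarrow> (\<exists>v \<in> eigenspace_on W A c. v \<noteq> 0)"

text \<open>
  For a symmetric operator the algebraic multiplicity of an eigenvalue is the dimension of its
  eigenspace, so the latter is what each eigenvalue contributes to the count below. Lemma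
  \<open>finite_eigenvalue_on\<close> ensures that the sum never ranges over an infinite set.
\<close>

definition morse_index_on :: "(real ^ 'n::finite) set \<Rightarrow> real ^ 'n ^ 'n \<Rightarrow> nat" where
  "morse_index_on W A = (\<Sum>c | eigenvalue_on W A c \<and> c < 0. dim (eigenspace_on W A c))"

lemma finite_eigenvalue_on:
  fixes A :: "real ^ 'n::finite ^ 'n"
  assumes "transpose A = A"
  shows "finite {c. eigenvalue_on W A c}"
proof -
  let ?S = "{c. eigenvalue_on W A c}"
  have "\<forall>c\<in>?S. \<exists>v. v \<noteq> 0 \<and> A *v v = c *\<^sub>R v"
    by (auto simp: eigenvalue_on_def eigenspace_on_def scalar_mult_eq_scaleR)
  from bchoice[OF this] obtain f where f: "\<And>c. c \<in> ?S \<Longrightarrow> f c \<noteq> 0 \<and> A *v f c = c *\<^sub>R f c"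
    by blast
  have orth: "f c \<bullet> f d = 0" if "c \<in> ?S" "d \<in> ?S" "c \<noteq> d" for c d
  proof -
    have "c * (f c \<bullet> f d) = (A *v f c) \<bullet> f d"
      using f[OF that(1)] by simp
    also have "\<dots> = f c \<bullet> (A *v f d)"
      using dot_lmul_matrix[of "f c" A "f d"] transpose_matrix_vector[of A "f c"] assms
      by simp
    also have "\<dots> = d * (f c \<bullet> f d)"
      using f[OF that(2)] by simp
    finally show ?thesis using that(3) by simp
  qed
  have inj: "inj_on f ?S"
  proof (rule inj_onI, rule ccontr)
    fix c d assume cd: "c \<in> ?S" "d \<in> ?S" "f c = f d" "c \<noteq> d"
    then have "f c \<bullet> f c = 0"
      using orth[of c d] by simp
    with f[OF cd(1)] show False by simp
  qed
  have "pairwise orthogonal (f ` ?S)"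
    unfolding pairwise_def orthogonal_def using orth by blast
  moreover have "0 \<notin> f ` ?S"
    using f by force
  ultimately have "independent (f ` ?S)"
    by (rule pairwise_orthogonal_independent)
  then have "finite (f ` ?S)"
    by (rule independent_imp_finite)
  then show ?thesis
    using inj finite_imageD by blast
qed

end

theory Submission
  imports Defs
begin

text \<open>
  A real matrix without eigenvalues in \<open>(-\<infinity>, 0]\<close> has positive determinant, because the segment from
  it to the identity stays invertible. Extend \<open>B\<close> from \<open>W\<close> to the whole space by the identity on
  the orthogonal complement, obtaining \<open>C\<close>. Neither \<open>J\<close> (as \<open>J\<^sup>2 = -1\<close>) nor \<open>J C\<close> (by spectral
  stability) has eigenvalues in \<open>(-\<infinity>, 0]\<close>, so \<open>det C > 0\<close>. If \<open>R\<close> is the product of the reflections along an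
  orthonormal set of eigenvectors of \<open>B\<close> spanning its negative eigenspaces in \<open>W\<close>, then \<open>R C\<close> has no
  eigenvalues in \<open>(-\<infinity>, 0]\<close> either, so \<open>0 < det R = (-1)\<^sup>k\<close> where \<open>k\<close> is the Morse index.
\<close>

section \<open>Real eigenvalues and the sign of the determinant\<close>

lemma det_pos_if_no_nonpos_eigenvalue:
  fixes A :: "real ^ 'n ^ 'n"
  assumes "\<And>t v. t \<ge> 0 \<Longrightarrow> A *v v = - t *\<^sub>R v \<Longrightarrow> v = 0"
  shows "det A > 0"
proof (rule ccontr)
  define M where "M = (\<lambda>t::real. (1 - t) *\<^sub>R A + t *\<^sub>R (mat 1 :: real ^ 'n ^ 'n))"
  assume "\<not> det A > 0"
  then have "det (M 0) \<le> 0" "0 \<le> det (M 1)"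
    by (simp_all add: M_def)
  moreover have "continuous_on {0..1} (\<lambda>t. det (M t))"
    unfolding det_def M_def by (auto intro!: continuous_intros)
  ultimately obtain t where t: "0 \<le> t" "t \<le> 1" "det (M t) = 0"
    using IVT'[of "\<lambda>t. det (M t)" 0 0 1] by auto
  then have "t < 1"
    by (cases "t = 1") (auto simp: M_def)
  from t(3) obtain v where v: "v \<noteq> 0" "M t *v v = 0"
    using invertible_det_nz[of "M t"] invertible_left_inverse[of "M t"]
      matrix_left_invertible_ker[of "M t"] by auto
  \<comment> \<open>A kernel vector of \<open>M t\<close> is an eigenvector of \<open>A\<close> for
    -t/(1 - t), a number that is at most 0; the assumption excludes this. The division is possible
    since \<open>M 1\<close> is the identity, whence \<open>t < 1\<close>.\<close>
  have "(1 - t) *\<^sub>R (A *v v) = - t *\<^sub>R v"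
    using v(2) by (simp add: M_def matrix_vector_mult_add_rdistrib scaleR_matrix_vector_assoc[symmetric]
        add_eq_0_iff)
  then have "(1 - t) *\<^sub>R (A *v v) = (1 - t) *\<^sub>R (- (t / (1 - t)) *\<^sub>R v)"
    using \<open>t < 1\<close> by simp
  then have "A *v v = - (t / (1 - t)) *\<^sub>R v"
    using \<open>t < 1\<close> by (subst (asm) scaleR_cancel_left) simp
  then show False
    using assms[of "t / (1 - t)" v] t \<open>t < 1\<close> v(1) by simp
qed

section \<open>Reflections and their determinants\<close>

lemma linear_reflection: "linear (\<lambda>v::'a::euclidean_space. v - (2 * (v \<bullet> e)) *\<^sub>R e)"
  by (rule linearI) (auto simp: algebra_simps)

text \<open>An orthogonal map \<open>f\<close> carrying \<open>e\<close> to a coordinate axis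
  conjugates the reflection into the diagonal matrix \<open>D\<close>, whose only entry -1 sits at
  the arbitrary index \<open>k\<close>. The nonzero determinant of \<open>f\<close> then
  cancels.\<close>

lemma det_reflection:
  fixes e :: "real ^ 'n"
  assumes "norm e = 1"
  shows "det (matrix (\<lambda>v. v - (2 * (v \<bullet> e)) *\<^sub>R e)) = - 1"
proof -
  define k :: 'n where "k = undefined"
  define D :: "real ^ 'n ^ 'n" where
    "D = (\<chi> i j. if i = j then if i = k then - 1 else 1 else 0)"
  let ?H = "\<lambda>v. v - (2 * (v \<bullet> e)) *\<^sub>R e"
  obtain f :: "real ^ 'n \<Rightarrow> real ^ 'n" where f: "orthogonal_transformation f" "f e = axis k 1"
    using orthogonal_transformation_exists_1[of e "axis k 1"] assms by auto
  then have lin: "linear f" and inner: "\<And>v w. f v \<bullet> f w = v \<bullet> w"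
    by (auto simp: orthogonal_transformation_def)
  have D: "D *v w = w - (2 * (w \<bullet> axis k 1)) *\<^sub>R axis k 1" for w
  proof -
    have "(D *v w) $ i = (\<Sum>j\<in>UNIV. if i = j then (if i = k then - 1 else 1) * w $ j else 0)" for i
      unfolding matrix_vector_mult_def D_def vec_lambda_beta by (rule sum.cong) auto
    then show ?thesis
      by (simp add: vec_eq_iff inner_axis) (simp add: axis_def)
  qed
  have "f \<circ> ?H = (*v) D \<circ> f"
  proof
    fix v
    have "w \<bullet> axis k 1 = v \<bullet> e" if "w = f v" for w
      using inner[of v e] f(2) that by simp
    then show "(f \<circ> ?H) v = ((*v) D \<circ> f) v"
      by (simp add: D linear_diff[OF lin] linear_scale[OF lin] f(2))
  qed
  then have "matrix f ** matrix ?H = D ** matrix f"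
    using matrix_compose[OF linear_reflection[of e] lin]
      matrix_compose[OF lin matrix_vector_mul_linear[of D]] by simp
  then have "det (matrix f) * det (matrix ?H) = det D * det (matrix f)"
    by (metis det_mul)
  moreover have "det (matrix f) \<noteq> 0"
    using f(1) det_orthogonal_matrix orthogonal_transformation_matrix by force
  moreover have "det D = - 1"
    by (subst det_diagonal) (auto simp: D_def prod.delta)
  ultimately show ?thesis
    by (metis mult.commute mult_cancel_left)
qed

text \<open>The sum describes a composition of reflections: removing components along
  \<open>S\<close> leaves the component along a new orthogonal vector \<open>a\<close> unchanged, so
  inserting \<open>a\<close> composes with one more reflection and multiplies the determinant by
  -1.\<close>

lemma det_reflections:
  fixes S :: "(real ^ 'n) set"
  assumes "finite S" "pairwise orthogonal S" "\<And>e. e \<in> S \<Longrightarrow> norm e = 1"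
  shows "det (matrix (\<lambda>v. v - (\<Sum>e\<in>S. (2 * (v \<bullet> e)) *\<^sub>R e))) = (- 1) ^ card S"
  using assms
proof (induction S)
  case empty
  then show ?case
    by (simp add: matrix_id_mat_1[unfolded id_def])
next
  case (insert a S)
  let ?R = "\<lambda>v. v - (\<Sum>e\<in>S. (2 * (v \<bullet> e)) *\<^sub>R e)"
  let ?H = "\<lambda>v. v - (2 * (v \<bullet> a)) *\<^sub>R a"
  have lin: "linear ?R"
    by (rule linearI) (auto simp: algebra_simps sum.distrib scaleR_sum_right)
  have orth: "e \<bullet> a = 0" if "e \<in> S" for e
    using insert.prems(1) insert.hyps(2) that by (force simp: pairwise_insert orthogonal_def)
  have "?R v \<bullet> a = v \<bullet> a" for v
    by (simp add: inner_diff_left inner_sum_left orth)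
  then have "?H \<circ> ?R = (\<lambda>v. v - (\<Sum>e\<in>insert a S. (2 * (v \<bullet> e)) *\<^sub>R e))"
    using insert.hyps by (auto simp: fun_eq_iff)
  then have "matrix (\<lambda>v. v - (\<Sum>e\<in>insert a S. (2 * (v \<bullet> e)) *\<^sub>R e)) = matrix ?H ** matrix ?R"
    using matrix_compose[OF lin linear_reflection[of a]] by simp
  moreover have "det (matrix ?R) = (- 1) ^ card S"
    using insert by (simp add: pairwise_insert)
  ultimately show ?case
    using insert by (simp add: det_mul det_reflection)
qed

section \<open>Orthogonal projection onto a subspace\<close>

lemma orthogonal_projection_exists:
  fixes W :: "'a::euclidean_space set"
  assumes "subspace W"
  obtains P where "linear P" "\<And>v. P v \<in> W" "\<And>v w. w \<in> W \<Longrightarrow> (v - P v) \<bullet> w = 0"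
proof -
  obtain E where E: "E \<subseteq> W" "pairwise orthogonal E" "\<And>x. x \<in> E \<Longrightarrow> norm x = 1"
    "independent E" "span E = W"
    using orthonormal_basis_subspace[OF assms] by metis
  define P where "P = (\<lambda>v. \<Sum>e\<in>E. (v \<bullet> e) *\<^sub>R e)"
  have "finite E"
    using E(4) independent_imp_finite by blast
  have delta: "e \<bullet> b = (if e = b then 1 else 0)" if "e \<in> E" "b \<in> E" for e b
    using E(2,3) that by (auto simp: pairwise_def orthogonal_def norm_eq_1)
  have "linear P"
    unfolding P_def by (rule linearI) (auto simp: algebra_simps sum.distrib scaleR_sum_right)
  moreover have "P v \<in> W" for v
    unfolding P_def using E(1) assms by (intro subspace_sum subspace_scale) auto
  moreover have "(v - P v) \<bullet> w = 0" if "w \<in> W" for v w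
  proof -
    have "orthogonal (v - P v) b" if "b \<in> E" for b
    proof -
      have "P v \<bullet> b = (\<Sum>e\<in>E. if e = b then v \<bullet> e else 0)"
        unfolding P_def inner_sum_left using that by (intro sum.cong) (auto simp: delta)
      then show ?thesis
        using \<open>finite E\<close> that by (simp add: orthogonal_def inner_diff_left)
    qed
    then show ?thesis
      using orthogonal_to_span[of w E "v - P v"] that E(5) by (auto simp: orthogonal_def)
  qed
  ultimately show ?thesis
    using that by blast
qed

section \<open>The matrix J and real eigenvalues\<close>

lemma sum_UNIV_Plus:
  "sum f (UNIV :: ('a::finite + 'b::finite) set) = (\<Sum>a\<in>UNIV. f (Inl a)) + (\<Sum>b\<in>UNIV. f (Inr b))"
  using sum.Plus[of "UNIV :: 'a set" "UNIV :: 'b set" f] by (simp add: comp_def)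

lemma symplectic_J_nth:
  "(symplectic_J *v v) $ Inl a = - v $ Inr a" "(symplectic_J *v v) $ Inr a = v $ Inl a"
proof -
  have *: "(\<Sum>b\<in>UNIV. (if a = b then c else 0) * f b) = c * f a" for c :: real and f
    by (subst sum.cong[OF refl, of UNIV _ "\<lambda>b. if a = b then c * f b else 0"]) auto
  show "(symplectic_J *v v) $ Inl a = - v $ Inr a" "(symplectic_J *v v) $ Inr a = v $ Inl a"
    unfolding matrix_vector_mult_def symplectic_J_def sum_UNIV_Plus by (simp_all add: *)
qed

lemma symplectic_J_square: "symplectic_J *v (symplectic_J *v v) = - v"
  unfolding vec_eq_iff
proof
  fix i
  show "(symplectic_J *v (symplectic_J *v v)) $ i = (- v) $ i"
    by (cases i) (simp_all add: symplectic_J_nth)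
qed

lemma transpose_symplectic_J: "transpose symplectic_J = - symplectic_J"
  by (auto simp: transpose_def symplectic_J_def vec_eq_iff split: sum.splits)

lemma inner_matrix_vector:
  fixes A :: "real ^ 'n ^ 'm"
  shows "(A *v v) \<bullet> w = v \<bullet> (transpose A *v w)"
  by (metis dot_lmul_matrix inner_commute transpose_matrix_vector transpose_transpose)

lemma inner_symplectic_J: "(symplectic_J *v v) \<bullet> w = - (v \<bullet> (symplectic_J *v w))"
  \<comment> \<open>With first matrix \<open>0\<close>, the difference rule moves the minus sign out
    of the product of -J with \<open>w\<close>.\<close>
  using matrix_vector_mult_diff_rdistrib[of 0 symplectic_J w]
  by (simp add: inner_matrix_vector transpose_symplectic_J)

text \<open>Applying J twice multiplies \<open>v\<close> by \<open>t * t\<close> but also by -1, and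
  no real square is -1.\<close>

lemma symplectic_J_no_real_eigenvalue:
  assumes "symplectic_J *v v = t *\<^sub>R v"
  shows "v = 0"
proof -
  have "- v = (t * t) *\<^sub>R v"
    using symplectic_J_square[of v] by (simp add: assms matrix_vector_mult_scaleR)
  then have "(1 + t * t) *\<^sub>R v = 0"
    by (metis add.right_inverse scaleR_add_left scaleR_one)
  moreover have "1 + t * t \<noteq> 0"
    by (smt (verit) zero_le_square)
  ultimately show ?thesis
    by simp
qed

text \<open>A real eigenvector is also one of the complexified matrix, so its eigenvalue is both
  real and purely imaginary.\<close>

lemma spectrally_stable_real_eigenvalue:
  fixes A :: "real ^ 'n ^ 'n"
  assumes "spectrally_stable A" "A *v v = t *\<^sub>R v" "v \<noteq> 0"
  shows "t = 0"
proof -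
  let ?v = "\<chi> i. complex_of_real (v $ i)"
  have "map_matrix complex_of_real A *v ?v = complex_of_real t *s ?v"
    using assms(2) by (simp add: vec_eq_iff matrix_vector_mult_def map_matrix_def
        flip: of_real_mult of_real_sum)
  moreover have "?v \<noteq> 0"
    using assms(3) by (simp add: vec_eq_iff)
  ultimately show ?thesis
    using assms(1) unfolding spectrally_stable_def eigenvalue_def by (metis Re_complex_of_real)
qed

theorem proposition5:
  fixes B :: "real ^ ('n::finite + 'n) ^ ('n + 'n)"
    and W :: "(real ^ ('n + 'n)) set"
  assumes "transpose B = B"
    and "subspace W"
    and "(\<lambda>v. symplectic_J *v v) ` W \<subseteq> W"
    and "(\<lambda>v. B *v v) ` W \<subseteq> W"
    and "bij_betw (\<lambda>v. B *v v) W W"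
    and "spectrally_stable (symplectic_J ** B)"
  shows "even (morse_index_on W B)"
proof -
  let ?J = "symplectic_J :: real ^ ('n + 'n) ^ ('n + 'n)"
  obtain P where P: "linear P" "\<And>v. P v \<in> W" "\<And>v w. w \<in> W \<Longrightarrow> (v - P v) \<bullet> w = 0"
    using orthogonal_projection_exists[OF assms(2)] by metis
  have BW: "B *v w \<in> W" and JW: "?J *v w \<in> W" if "w \<in> W" for w
    using assms(3,4) that by auto
  have B0: "w = 0" if "w \<in> W" "B *v w = 0" for w
    using assms(5) that subspace_0[OF assms(2)] matrix_vector_mult_0_right[of B]
    unfolding bij_betw_def inj_on_def by metis
  \<comment> \<open>W meets its orthogonal complement only in 0. This splits each eigenvector
    equation below into its component in W and its component orthogonal to W.\<close>
  have split0: "a = 0 \<and> b = 0" if "a \<in> W" "\<And>w. w \<in> W \<Longrightarrow> b \<bullet> w = 0" "a + b = 0" for a b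
    using that(2)[OF that(1)] that(3) by (metis add.right_neutral add_0 eq_neg_iff_add_eq_0 inner_eq_zero_iff
        inner_minus_left neg_equal_0_iff_equal)

  \<comment> \<open>The extension \<open>C\<close> of B and the sign of its determinant\<close>
  define C where "C = matrix (\<lambda>v. B *v P v + (v - P v))"
  have C: "C *v v = B *v P v + (v - P v)" for v
  proof -
    have "linear (\<lambda>v. B *v P v + (v - P v))"
      by (intro linear_compose_add linear_compose_sub linear_ident P(1)
          linear_compose[OF P(1) matrix_vector_mul_linear[of B], unfolded o_def])
    then show ?thesis
      unfolding C_def by (simp add: matrix_works)
  qed

  have "v = 0" if "?J *v v = - t *\<^sub>R v" for t v
    using symplectic_J_no_real_eigenvalue that by blast
  then have detJ: "det ?J > 0"
    by (intro det_pos_if_no_nonpos_eigenvalue)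
  have "det (?J ** C) > 0"
  proof (rule det_pos_if_no_nonpos_eigenvalue)
    fix t v assume "(?J ** C) *v v = - t *\<^sub>R v"
    then have eq: "?J *v (C *v v) = - t *\<^sub>R v"
      by (simp add: matrix_vector_mul_assoc)
    define w u where "w = P v" and "u = v - P v"
    have w: "w \<in> W" and u: "\<And>x. x \<in> W \<Longrightarrow> u \<bullet> x = 0" and v: "v = w + u"
      using P by (auto simp: w_def u_def)
    have "(?J *v (B *v w) + t *\<^sub>R w) + (?J *v u + t *\<^sub>R u) = 0"
    proof -
      have "?J *v (B *v w + u) = - t *\<^sub>R (w + u)"
        using eq by (simp add: C u_def w_def)
      then show ?thesis
        by (simp add: matrix_vector_right_distrib eq_neg_iff_add_eq_0 algebra_simps)
    qed
    moreover have "?J *v (B *v w) + t *\<^sub>R w \<in> W"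
      using w BW JW assms(2) by (simp add: subspace_add subspace_scale)
    \<comment> \<open>J is skew-symmetric and preserves W, hence it also preserves the orthogonal
      complement, where \<open>u\<close> lies.\<close>
    moreover have "(?J *v u + t *\<^sub>R u) \<bullet> x = 0" if "x \<in> W" for x
      using u that JW by (simp add: inner_add_left inner_symplectic_J)
    ultimately have *: "?J *v (B *v w) + t *\<^sub>R w = 0" "?J *v u + t *\<^sub>R u = 0"
      using split0 by blast+
    have "u = 0"
      using *(2) symplectic_J_no_real_eigenvalue[of u "- t"] by (simp add: eq_neg_iff_add_eq_0)
    have "w = 0"
    proof (rule ccontr)
      assume "w \<noteq> 0"
      have ev: "(?J ** B) *v w = (- t) *\<^sub>R w"
        using *(1) by (simp add: matrix_vector_mul_assoc eq_neg_iff_add_eq_0)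
      \<comment> \<open>Stability leaves only the eigenvalue 0, and that would put \<open>w\<close>
        in the kernel of B, since J is injective; but B is injective on W.\<close>
      then have "t = 0"
        using spectrally_stable_real_eigenvalue[OF assms(6) ev \<open>w \<noteq> 0\<close>] by simp
      then have "?J *v (B *v w) = 0 *\<^sub>R (B *v w)"
        using *(1) by simp
      then have "B *v w = 0"
        by (rule symplectic_J_no_real_eigenvalue)
      then show False
        using B0 w \<open>w \<noteq> 0\<close> by blast
    qed
    with \<open>u = 0\<close> show "v = 0"
      by (simp add: v)
  qed
  with detJ have detC: "det C > 0"
    by (simp add: det_mul zero_less_mult_iff)

  \<comment> \<open>Orthonormal eigenvectors for the negative eigenvalues\<close>
  define N where "N = {c. eigenvalue_on W B c \<and> c < 0}"
  have "finite N"
    using finite_eigenvalue_on[OF assms(1)] by (simp add: N_def)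
  have sub: "subspace (eigenspace_on W B c)" for c
    using assms(2) unfolding eigenspace_on_def subspace_def
    by (auto simp: matrix_vector_right_distrib matrix_vector_mult_scaleR scalar_mult_eq_scaleR
        scaleR_add_right)
  have "\<exists>E. E \<subseteq> eigenspace_on W B c \<and> pairwise orthogonal E \<and> (\<forall>x\<in>E. norm x = 1) \<and>
      independent E \<and> card E = dim (eigenspace_on W B c) \<and> span E = eigenspace_on W B c" for c
    using orthonormal_basis_subspace[OF sub[of c]] by metis
  then obtain E where E: "\<And>c. E c \<subseteq> eigenspace_on W B c" "\<And>c. pairwise orthogonal (E c)"
    "\<And>c x. x \<in> E c \<Longrightarrow> norm x = 1" "\<And>c. independent (E c)"
    "\<And>c. card (E c) = dim (eigenspace_on W B c)" "\<And>c. span (E c) = eigenspace_on W B c"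
    by metis
  have finE: "finite (E c)" for c
    using E(4) independent_imp_finite by blast
  have EW: "e \<in> W" and EB: "B *v e = c *\<^sub>R e" if "e \<in> E c" for c e
    using E(1)[of c] that by (auto simp: eigenspace_on_def scalar_mult_eq_scaleR)
  have orthE: "e \<bullet> f = 0" if "e \<in> E c" "f \<in> E d" "c \<noteq> d" for c d e f
  proof -
    have "c * (e \<bullet> f) = d * (e \<bullet> f)"
      using inner_matrix_vector[of B e f] EB that(1,2) assms(1) by simp
    then show ?thesis
      using that(3) by simp
  qed
  define S where "S = (\<Union>c\<in>N. E c)"
  have "finite S"
    using \<open>finite N\<close> finE by (simp add: S_def)
  have normS: "norm e = 1" if "e \<in> S" for e
    using that E(3) by (auto simp: S_def)
  have orthS: "pairwise orthogonal S"
    using E(2) orthE unfolding S_def pairwise_def orthogonal_def by (metis UN_E)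
  \<comment> \<open>A common element would be a unit vector orthogonal to itself. Disjointness lets
    the cardinalities add up to the Morse index.\<close>
  have "E c \<inter> E d = {}" if "c \<noteq> d" for c d
    using orthE[OF _ _ that] E(3) by (metis disjoint_iff inner_eq_zero_iff norm_zero zero_neq_one)
  then have cardS: "card S = morse_index_on W B"
    unfolding S_def using \<open>finite N\<close> finE
    by (subst card_UN_disjoint) (auto simp: E(5) morse_index_on_def N_def)

  \<comment> \<open>The product \<open>R\<close> of reflections and the sign of its
    determinant\<close>
  define R where "R = matrix (\<lambda>v. v - (\<Sum>e\<in>S. (2 * (v \<bullet> e)) *\<^sub>R e))"
  have R: "R *v v = v - (\<Sum>e\<in>S. (2 * (v \<bullet> e)) *\<^sub>R e)" for v
  proof -
    have "linear (\<lambda>v. v - (\<Sum>e\<in>S. (2 * (v \<bullet> e)) *\<^sub>R e))"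
      by (rule linearI) (auto simp: algebra_simps sum.distrib scaleR_sum_right)
    then show ?thesis
      unfolding R_def by (simp add: matrix_works)
  qed
  have RS: "(R *v v) \<bullet> b = - (v \<bullet> b)" if "b \<in> S" for v b
  proof -
    have "(\<Sum>e\<in>S. (2 * (v \<bullet> e)) *\<^sub>R e) \<bullet> b = (\<Sum>e\<in>S. if e = b then 2 * (v \<bullet> e) else 0)"
      unfolding inner_sum_left using orthS normS that
      by (intro sum.cong) (auto simp: pairwise_def orthogonal_def norm_eq_1)
    then show ?thesis
      using that \<open>finite S\<close> by (simp add: R inner_diff_left)
  qed
  \<comment> \<open>As \<open>e\<close> lies in W, \<open>v\<close> and \<open>P v\<close> have the
    same inner product with \<open>e\<close>, and the part \<open>v - P v\<close> contributes
    nothing; the symmetry of B then moves it onto \<open>e\<close>.\<close>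
  have CE: "(C *v v) \<bullet> e = c * (v \<bullet> e)" if "e \<in> E c" for v c e
    using P(3)[OF EW[OF that], of v] inner_matrix_vector[of B "P v" e] assms(1) EB[OF that]
    by (simp add: C inner_add_left inner_diff_left)

  have "det (R ** C) > 0"
  proof (rule det_pos_if_no_nonpos_eigenvalue)
    fix t :: real and v assume t: "t \<ge> 0" and "(R ** C) *v v = - t *\<^sub>R v"
    then have eq: "R *v (C *v v) = - t *\<^sub>R v"
      by (simp add: matrix_vector_mul_assoc)
    \<comment> \<open>On the line of \<open>e\<close>, \<open>C\<close> acts as \<open>c\<close> and
      \<open>R\<close> as -1, so the equation becomes
      \<open>c * (v \<bullet> e) = t * (v \<bullet> e)\<close> with \<open>c < 0\<close> and
      \<open>t \<ge> 0\<close>.\<close>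
    have vE: "v \<bullet> e = 0" if "c \<in> N" "e \<in> E c" for c e
    proof -
      have "e \<in> S"
        using that by (auto simp: S_def)
      then have "c * (v \<bullet> e) = t * (v \<bullet> e)"
        using RS[of e "C *v v"] CE[OF that(2), of v] eq by auto
      then show ?thesis
        using t that(1) by (auto simp: N_def)
    qed
    \<comment> \<open>Being orthogonal to \<open>S\<close>, the vector \<open>C *v v\<close> is
      fixed by \<open>R\<close>, which thus drops out of the equation.\<close>
    then have "(C *v v) \<bullet> e = 0" if "e \<in> S" for e
      using that CE by (auto simp: S_def)
    then have "C *v v = - t *\<^sub>R v"
      using eq by (simp add: R)
    define w u where "w = P v" and "u = v - P v"
    have w: "w \<in> W" and u: "\<And>x. x \<in> W \<Longrightarrow> u \<bullet> x = 0" and v: "v = w + u"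
      using P by (auto simp: w_def u_def)
    have "(B *v w + t *\<^sub>R w) + (1 + t) *\<^sub>R u = 0"
    proof -
      have "B *v w + u = - t *\<^sub>R (w + u)"
        using \<open>C *v v = - t *\<^sub>R v\<close> by (simp add: C u_def w_def)
      then show ?thesis
        by (simp add: eq_neg_iff_add_eq_0 algebra_simps)
    qed
    moreover have "B *v w + t *\<^sub>R w \<in> W"
      using w BW assms(2) by (simp add: subspace_add subspace_scale)
    ultimately have "B *v w + t *\<^sub>R w = 0 \<and> (1 + t) *\<^sub>R u = 0"
      using u by (intro split0) auto
    then have Bw: "B *v w = (- t) *\<^sub>R w" and "u = 0"
      using t by (auto simp: eq_neg_iff_add_eq_0)
    have "w = 0"
    proof (rule ccontr)
      assume "w \<noteq> 0"
      \<comment> \<open>Injectivity of B on W rules out \<open>t = 0\<close>, so -t is a negative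
        eigenvalue. Then \<open>w\<close> lies in the span of \<open>E (- t)\<close> and, by
        \<open>vE\<close>, is orthogonal to it, hence to itself.\<close>
      then have "t \<noteq> 0"
        using B0[OF w] Bw by auto
      have wE: "w \<in> eigenspace_on W B (- t)"
        using w Bw by (simp add: eigenspace_on_def scalar_mult_eq_scaleR)
      then have "- t \<in> N"
        using t \<open>t \<noteq> 0\<close> \<open>w \<noteq> 0\<close> by (auto simp: N_def eigenvalue_on_def)
      then have "orthogonal w e" if "e \<in> E (- t)" for e
        using vE that v \<open>u = 0\<close> by (simp add: orthogonal_def)
      then have "orthogonal w w"
        using orthogonal_to_span[of w "E (- t)" w] wE E(6) by auto
      with \<open>w \<noteq> 0\<close> show False
        by (simp add: orthogonal_def)
    qed
    with \<open>u = 0\<close> show "v = 0"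
      by (simp add: v)
  qed
  with detC have "det R > 0"
    by (simp add: det_mul zero_less_mult_iff)
  then have "(- 1 :: real) ^ morse_index_on W B > 0"
    using det_reflections[OF \<open>finite S\<close> orthS normS] by (simp add: R_def cardS)
  then show ?thesis
    by (cases "even (morse_index_on W B)") auto
qed

end
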